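(* For $n\geq 0$, let $Q(\mathcal{PP}_n)$ be the set of projections of the planar partition monoid $\mathcal{PP}_n$ of rank at most $2$. Then $$|Q(\mathcal{PP}_n)|=C(n+2)-2C(n+1)+C(n),$$ where $C(m)$ denotes the $m$th Catalan number.
   Context: For an integer $n\ge 0$ let $\mathbf n=\{1,\dots,n\}$ and $\mathbf n'=\{1',\dots,n'\}$. The partition monoid $\mathcal P_n$ is the set of all set partitions of $\mathbf n\cup\mathbf n'$. Product of $\alpha,\beta\in\mathcal P_n$: with $\mathbf n''=\{1'',\dots,n''\}$, rename each $x'$ in $\alpha$ as $x''$ and each (unprimed) $x$ in $\beta$ as $x''$; consider the equivalence on $\mathbf n\cup\mathbf n''\cup\mathbf n'$ generated by the blocks of these two renamed partitions; $x,y\in\mathbf n\cup\mathbf n'$ are in the same block of $\alpha\beta$ iff they are related by this equivalence. $\alpha^*$ is obtained from $\alpha$ by interchanging $x$ and $x'$ for all $x$. The rank of $\alpha$ is the number of its blocks meeting both $\mathbf n$ and $\mathbf n'$. A projection is an element $\varepsilon$ with $\varepsilon^2=\varepsilon=\varepsilon^*$. $\alpha$ is planar if it can be drawn by a graph, whose connected components are the blocks, with vertices $1,\dots,n$ in order on an upper row and $1',\dots,n'$ in order on a lower row, with all edges inside the rectangle spanned by the vertices and with no crossings (equivalently, $\alpha$ is a non-crossing partition for the cyclic order $1,\dots,n,n',\dots,1'$). $\mathcal{PP}_n$ is the submonoid of $\mathcal P_n$ of all planar partitions. $C(m)=\frac1{m+1}\binom{2m}{m}$. *)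

theory Defs
  imports Complex_Main "HOL-Library.Disjoint_Sets"
begin

text \<open>\<open>Upper i\<close>, \<open>Lower i\<close> and \<open>Middle i\<close> stand for \<open>i\<close>, \<open>i'\<close> and \<open>i''\<close>; the middle row only
  serves to form products.\<close>

datatype vertex = Upper nat | Lower nat | Middle nat

definition upper_row :: "nat \<Rightarrow> vertex set" where
  "upper_row n = Upper ` {1..n}"

definition lower_row :: "nat \<Rightarrow> vertex set" where
  "lower_row n = Lower ` {1..n}"

definition vertices :: "nat \<Rightarrow> vertex set" where
  "vertices n = upper_row n \<union> lower_row n"

definition partition_monoid :: "nat \<Rightarrow> vertex set set set" where
  "partition_monoid n = {\<alpha>. partition_on (vertices n) \<alpha>}"

fun lower_to_middle :: "vertex \<Rightarrow> vertex" where
  "lower_to_middle (Upper i) = Upper i"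
| "lower_to_middle (Lower i) = Middle i"
| "lower_to_middle (Middle i) = Middle i"

fun upper_to_middle :: "vertex \<Rightarrow> vertex" where
  "upper_to_middle (Upper i) = Middle i"
| "upper_to_middle (Lower i) = Lower i"
| "upper_to_middle (Middle i) = Middle i"

fun swap_rows :: "vertex \<Rightarrow> vertex" where
  "swap_rows (Upper i) = Lower i"
| "swap_rows (Lower i) = Upper i"
| "swap_rows (Middle i) = Middle i"

definition rename :: "(vertex \<Rightarrow> vertex) \<Rightarrow> vertex set set \<Rightarrow> vertex set set" where
  "rename f \<alpha> = (\<lambda>A. f ` A) ` \<alpha>"

text \<open>\<^const>\<open>equivclp\<close> is reflexive on the whole type; this only adds trivial pairs, and
  \<open>pmult\<close> looks at vertices of the upper and lower rows only.\<close>

definition product_rel :: "vertex set set \<Rightarrow> vertex set set \<Rightarrow> vertex \<Rightarrow> vertex \<Rightarrow> bool" where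
  "product_rel \<alpha> \<beta> = equivclp (\<lambda>x y.
     \<exists>B \<in> rename lower_to_middle \<alpha> \<union> rename upper_to_middle \<beta>. x \<in> B \<and> y \<in> B)"

definition pmult :: "nat \<Rightarrow> vertex set set \<Rightarrow> vertex set set \<Rightarrow> vertex set set" where
  "pmult n \<alpha> \<beta> =
     vertices n // {(x, y). x \<in> vertices n \<and> y \<in> vertices n \<and> product_rel \<alpha> \<beta> x y}"

definition pstar :: "vertex set set \<Rightarrow> vertex set set" where
  "pstar \<alpha> = rename swap_rows \<alpha>"

definition prank :: "nat \<Rightarrow> vertex set set \<Rightarrow> nat" where
  "prank n \<alpha> = card {A \<in> \<alpha>. A \<inter> upper_row n \<noteq> {} \<and> A \<inter> lower_row n \<noteq> {}}"

text \<open>Position along the boundary of the rectangle, in the order \<open>1, \<dots>, n, n', \<dots>, 1'\<close>.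
  Cutting the cyclic order at one point does not affect which pairs of blocks cross.\<close>

fun boundary_pos :: "nat \<Rightarrow> vertex \<Rightarrow> int" where
  "boundary_pos n (Upper i) = int i"
| "boundary_pos n (Lower i) = 2 * int n + 1 - int i"
| "boundary_pos n (Middle i) = 0"

definition blocks_cross :: "nat \<Rightarrow> vertex set \<Rightarrow> vertex set \<Rightarrow> bool" where
  "blocks_cross n A B \<longleftrightarrow> (\<exists>a\<in>A. \<exists>b\<in>B. \<exists>c\<in>A. \<exists>d\<in>B.
     boundary_pos n a < boundary_pos n b \<and> boundary_pos n b < boundary_pos n c \<and>
     boundary_pos n c < boundary_pos n d)"

definition planar :: "nat \<Rightarrow> vertex set set \<Rightarrow> bool" where
  "planar n \<alpha> \<longleftrightarrow> (\<forall>A\<in>\<alpha>. \<forall>B\<in>\<alpha>. A \<noteq> B \<longrightarrow> \<not> blocks_cross n A B)"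

definition planar_partition_monoid :: "nat \<Rightarrow> vertex set set set" where
  "planar_partition_monoid n = {\<alpha> \<in> partition_monoid n. planar n \<alpha>}"

definition projections :: "nat \<Rightarrow> vertex set set set \<Rightarrow> vertex set set set" where
  "projections n S = {\<epsilon> \<in> S. pmult n \<epsilon> \<epsilon> = \<epsilon> \<and> \<epsilon> = pstar \<epsilon>}"

definition Q_PP :: "nat \<Rightarrow> vertex set set set" where
  "Q_PP n = {\<epsilon> \<in> projections n (planar_partition_monoid n). prank n \<epsilon> \<le> 2}"

definition catalan :: "nat \<Rightarrow> real" where
  "catalan m = 1 / (real m + 1) * real ((2 * m) choose m)"

end

theory Submission
  imports Defs
begin

text \<open>A planar partition with \<open>\<alpha> = \<alpha>\<^sup>*\<close> has no transversal block \<open>A \<union> C'\<close> with \<open>A \<noteq> C\<close>, since it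
  would cross its mirror image \<open>C \<union> A'\<close>. So a projection is given by a non-crossing partition of
  \<open>{1, \<dots>, n}\<close> with \<open>k\<close> marked blocks, none of which is covered by another block, and every such
  datum is idempotent. Reading marked blocks as open ones, the column \<open>n + 1\<close> forms a new
  closed or open block, or extends the rightmost open block, which then stays open or gets closed.
  Hence the numbers \<open>t n k\<close> of projections of rank \<open>k\<close> satisfy \<open>t (n + 1) 0 = t n 0 + t n 1\<close> and
  \<open>t (n + 1) (k + 1) = t n k + 2 * t n (k + 1) + t n (k + 2)\<close>. This yields
  \<open>t n k = (2 * n choose (n + k)) - (2 * n choose (n + k + 1))\<close>, so \<open>t n 0\<close> is the Catalan number,
  and applying the recurrence twice rewrites \<open>t (n + 2) 0 - 2 * t (n + 1) 0 + t n 0\<close> as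
  \<open>t n 0 + t n 1 + t n 2\<close>.\<close>

subsection \<open>Non-crossing partitions with marked blocks\<close>

text \<open>One-sided: the leftmost of the four points belongs to \<open>A\<close>. The condition in
  \<open>configs\<close> ranges over ordered pairs, so it excludes both orders.\<close>

definition crosses :: "nat set \<Rightarrow> nat set \<Rightarrow> bool" where
  "crosses A B \<longleftrightarrow> (\<exists>a\<in>A. \<exists>b\<in>B. \<exists>c\<in>A. \<exists>d\<in>B. a < b \<and> b < c \<and> c < d)"

text \<open>A transversal block with a point enclosed by \<open>A\<close> in its row could not reach
  the other row without crossing \<open>A\<close>.\<close>

definition covers :: "nat set \<Rightarrow> nat set \<Rightarrow> bool" where
  "covers A B \<longleftrightarrow> (\<exists>a\<in>A. \<exists>b\<in>B. \<exists>c\<in>A. a < b \<and> b < c)"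

text \<open>Vacuous for empty sets; it behaves like a strict order only because blocks are
  nonempty.\<close>

definition right_of :: "nat set \<Rightarrow> nat set \<Rightarrow> bool" where
  "right_of A B \<longleftrightarrow> (\<forall>a\<in>A. \<forall>b\<in>B. b < a)"

text \<open>A pair \<open>(N, Ms)\<close> encodes a symmetric planar partition: \<open>N\<close> consists of the sets occurring as a
  block in each row separately, \<open>Ms\<close> lists the transversal blocks from right to left. In the scan
  over the columns \<open>1, \<dots>, n\<close>, \<open>Ms\<close> is the stack of blocks that are still open.\<close>

definition configs :: "nat \<Rightarrow> nat \<Rightarrow> (nat set set \<times> nat set list) set" where
  "configs n k = {(N, Ms). length Ms = k \<and> partition_on {1..n} (N \<union> set Ms) \<and> N \<inter> set Ms = {} \<and>
     (\<forall>A\<in>N. \<forall>B\<in>N. A \<noteq> B \<longrightarrow> \<not> crosses A B) \<and> (\<forall>A\<in>N. \<forall>B\<in>set Ms. \<not> covers A B) \<and>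
     sorted_wrt right_of Ms}"

section \<open>Adding a point to a set partition and removing one\<close>

lemma partition_on_insert_singleton:
  assumes "partition_on A P" "x \<notin> A"
  shows "partition_on (insert x A) (insert {x} P)"
  using assms by (auto simp: partition_on_def disjoint_def)

lemma partition_on_insert_into_block:
  assumes "partition_on A P" "L \<in> P" "x \<notin> A"
  shows "partition_on (insert x A) (insert (insert x L) (P - {L}))"
proof -
  have "x \<notin> B" if "B \<in> P" for B
    using assms that unfolding partition_on_def by blast
  then have "disjoint (insert (insert x L) (P - {L}))"
    using assms(1,2) unfolding partition_on_def disjoint_def by (simp; blast)
  moreover have "\<Union>(insert (insert x L) (P - {L})) = insert x A"
    using assms(1,2) unfolding partition_on_def by blast
  ultimately show ?thesis
    using assms unfolding partition_on_def by auto
qed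

lemma partition_on_remove_singleton:
  assumes "partition_on (insert x A) P" "{x} \<in> P" "x \<notin> A"
  shows "partition_on A (P - {{x}})"
proof -
  have "\<Union>(P - {{x}}) = \<Union>P - {x}"
    using assms(1,2) unfolding partition_on_def disjoint_def by fastforce
  then show ?thesis
    using assms by (auto simp: partition_on_def disjoint_def)
qed

lemma partition_on_remove_from_block:
  assumes "partition_on (insert x A) P" "B \<in> P" "x \<in> B" "B \<noteq> {x}" "x \<notin> A"
  shows "partition_on A (insert (B - {x}) (P - {B}))"
proof -
  have "x \<notin> C" if "C \<in> P - {B}" for C
    using assms that unfolding partition_on_def disjoint_def by blast
  then have "\<Union>(insert (B - {x}) (P - {B})) = \<Union>P - {x}"
    using assms(2,3) by blast
  moreover have "disjoint (insert (B - {x}) (P - {B}))"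
    using assms(1,2) unfolding partition_on_def disjoint_def by (simp; blast)
  ultimately show ?thesis
    using assms unfolding partition_on_def by auto
qed

lemma configs_0: "configs 0 k = (if k = 0 then {({}, [])} else {})"
  by (auto simp: configs_def partition_on_empty)

section \<open>The four moves of the column scan\<close>

fun add_closed :: "nat \<Rightarrow> nat set set \<times> nat set list \<Rightarrow> nat set set \<times> nat set list" where
  "add_closed x (N, Ms) = (insert {x} N, Ms)"

fun add_open :: "nat \<Rightarrow> nat set set \<times> nat set list \<Rightarrow> nat set set \<times> nat set list" where
  "add_open x (N, Ms) = (N, {x} # Ms)"

text \<open>As for \<open>close_top\<close>, the move is meaningful only for a nonempty stack, whose
  head is the rightmost open block.\<close>

fun extend_top :: "nat \<Rightarrow> nat set set \<times> nat set list \<Rightarrow> nat set set \<times> nat set list" where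
  "extend_top x (N, Ms) = (N, insert x (hd Ms) # tl Ms)"

fun close_top :: "nat \<Rightarrow> nat set set \<times> nat set list \<Rightarrow> nat set set \<times> nat set list" where
  "close_top x (N, Ms) = (insert (insert x (hd Ms)) N, tl Ms)"

lemma configs_block:
  assumes "(N, Ms) \<in> configs n k" "A \<in> N \<union> set Ms"
  shows "A \<noteq> {}" "A \<subseteq> {1..n}" "Suc n \<notin> A"
proof -
  have P: "partition_on {1..n} (N \<union> set Ms)" using assms(1) by (simp add: configs_def)
  then show "A \<noteq> {}" using assms(2) unfolding partition_on_def by blast
  show "A \<subseteq> {1..n}" using P assms(2) unfolding partition_on_def by blast
  then show "Suc n \<notin> A" by auto
qed

lemma configs_hd_notin_tl:
  assumes "(N, L # Ms) \<in> configs n k"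
  shows "L \<notin> set Ms"
proof
  assume "L \<in> set Ms"
  then have "right_of L L" using assms by (simp add: configs_def)
  then show False
    using configs_block(1)[OF assms, of L] by (auto simp: right_of_def)
qed

lemma add_closed_configs: "X \<in> configs n k \<Longrightarrow> add_closed (Suc n) X \<in> configs (Suc n) k"
proof (cases X)
  case (Pair N Ms)
  assume X: "X \<in> configs n k"
  note [simp] = Pair
  have *: "A \<subseteq> {1..n}" if "A \<in> N \<union> set Ms" for A
    using configs_block(2) X that by simp
  have "partition_on (insert (Suc n) {1..n}) (insert {Suc n} (N \<union> set Ms))"
    using X by (intro partition_on_insert_singleton) (auto simp: configs_def)
  moreover have "{Suc n} \<notin> set Ms" using *[of "{Suc n}"] by auto
  \<comment> \<open>A singleton offers one point, whereas \<open>crosses\<close> takes two from each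
    set and \<open>covers\<close> two from its first.\<close>
  moreover have "\<not> crosses A {Suc n}" "\<not> crosses {Suc n} A" "\<not> covers {Suc n} A" for A
    by (auto simp: crosses_def covers_def)
  ultimately show ?thesis using X
    by (auto simp: configs_def atLeastAtMostSuc_conv)
qed

lemma add_open_configs: "X \<in> configs n k \<Longrightarrow> add_open (Suc n) X \<in> configs (Suc n) (Suc k)"
proof (cases X)
  case (Pair N Ms)
  assume X: "X \<in> configs n k"
  note [simp] = Pair
  have *: "A \<subseteq> {1..n}" if "A \<in> N \<union> set Ms" for A
    using configs_block(2) X that by simp
  have lt: "a < Suc n" if "A \<in> N \<union> set Ms" "a \<in> A" for a A
    using *[OF that(1)] that(2) by auto
  have "partition_on (insert (Suc n) {1..n}) (insert {Suc n} (N \<union> set Ms))"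
    using X by (intro partition_on_insert_singleton) (auto simp: configs_def)
  moreover have "{Suc n} \<notin> N" using *[of "{Suc n}"] by auto
  moreover have "\<not> covers A {Suc n}" if "A \<in> N" for A
    using lt[of A] that by (fastforce simp: covers_def)
  moreover have "right_of {Suc n} A" if "A \<in> set Ms" for A
    using lt[of A] that by (auto simp: right_of_def)
  ultimately show ?thesis using X
    by (auto simp: configs_def atLeastAtMostSuc_conv)
qed

text \<open>Common ground of \<open>extend_top\<close> and \<open>close_top\<close>, which differ
  only in the component receiving the enlarged block. The new point exceeds all others, so it is
  never enclosed and preserves being to the right.\<close>

lemma configs_insert_top:
  assumes "(N, L # Ms) \<in> configs n k"
  shows "partition_on {1..Suc n} (insert (insert (Suc n) L) (N \<union> set Ms))"
    and "insert (Suc n) L \<notin> N \<union> set Ms"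
    and "\<And>A. A \<in> N \<Longrightarrow> \<not> covers A (insert (Suc n) L)"
    and "\<And>B. B \<in> set Ms \<Longrightarrow> right_of (insert (Suc n) L) B"
proof -
  note block = configs_block[OF assms]
  have lt: "a < Suc n" if "A \<in> N \<union> set (L # Ms)" "a \<in> A" for a A
    using block(2)[OF that(1)] that(2) by auto
  have "L \<notin> set Ms" "L \<notin> N"
    using configs_hd_notin_tl[OF assms] assms by (auto simp: configs_def)
  then have "N \<union> set Ms = N \<union> set (L # Ms) - {L}" by auto
  moreover have "partition_on (insert (Suc n) {1..n})
      (insert (insert (Suc n) L) (N \<union> set (L # Ms) - {L}))"
    using assms by (intro partition_on_insert_into_block) (auto simp: configs_def)
  ultimately show "partition_on {1..Suc n} (insert (insert (Suc n) L) (N \<union> set Ms))"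
    by (simp add: atLeastAtMostSuc_conv)
  show "insert (Suc n) L \<notin> N \<union> set Ms"
    using block(3)[of "insert (Suc n) L"] by auto
  show "\<not> covers A (insert (Suc n) L)" if "A \<in> N" for A
  proof -
    have "\<not> covers A L" using assms that by (auto simp: configs_def)
    then show ?thesis using lt[of A] that unfolding covers_def
      by (metis UnCI insertE not_less_iff_gr_or_eq)
  qed
  show "right_of (insert (Suc n) L) B" if "B \<in> set Ms" for B
    using assms lt[of B] that by (auto simp: configs_def right_of_def)
qed

lemma configs_SucE:
  assumes "X \<in> configs n (Suc k)"
  obtains N L Ms where "X = (N, L # Ms)" "(N, L # Ms) \<in> configs n (Suc k)"
  using assms by (cases X) (auto simp: configs_def length_Suc_conv)

lemma extend_top_configs:
  assumes "X \<in> configs n (Suc k)"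
  shows "extend_top (Suc n) X \<in> configs (Suc n) (Suc k)"
proof -
  obtain N L Ms where X: "X = (N, L # Ms)" and X': "(N, L # Ms) \<in> configs n (Suc k)"
    using assms by (rule configs_SucE)
  show ?thesis using X' configs_insert_top[OF X'] unfolding X
    by (auto simp: configs_def)
qed

lemma close_top_configs:
  assumes "X \<in> configs n (Suc k)"
  shows "close_top (Suc n) X \<in> configs (Suc n) k"
proof -
  obtain N L Ms where X: "X = (N, L # Ms)" and X': "(N, L # Ms) \<in> configs n (Suc k)"
    using assms by (rule configs_SucE)
  \<comment> \<open>A crossing in either order contains a point of the closed block between two
    points of \<open>A\<close>, so both orders are excluded by \<open>covers\<close>.\<close>
  have "\<not> crosses A (insert (Suc n) L)" if "A \<in> N" for A
    using configs_insert_top(3)[OF X' that] by (fastforce simp: crosses_def covers_def)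
  moreover have "\<not> crosses (insert (Suc n) L) A" if "A \<in> N" for A
    using configs_insert_top(3)[OF X' that] configs_block(2)[OF X', of A] that
    by (fastforce simp: crosses_def covers_def)
  moreover have "\<not> covers (insert (Suc n) L) B" if "B \<in> set Ms" for B
    using configs_insert_top(4)[OF X' that] by (fastforce simp: covers_def right_of_def)
  ultimately show ?thesis using X' configs_insert_top[OF X'] unfolding X
    by (auto simp: configs_def)
qed

text \<open>Two questions about the block containing the last column determine the move: whether it
  is in \<open>N\<close> or on the stack, and whether it is a singleton.\<close>

lemma configs_Suc_cases:
  assumes "Y \<in> configs (Suc n) k"
  obtains (closed) X where "X \<in> configs n k" "Y = add_closed (Suc n) X"
  | (opened) X j where "k = Suc j" "X \<in> configs n j" "Y = add_open (Suc n) X"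
  | (extended) X j where "k = Suc j" "X \<in> configs n k" "Y = extend_top (Suc n) X"
  | (closing) X where "X \<in> configs n (Suc k)" "Y = close_top (Suc n) X"
proof -
  obtain N Ms where Y: "Y = (N, Ms)" by (cases Y)
  note Y' = assms[unfolded Y]
  let ?x = "Suc n"
  have part: "partition_on (insert ?x {1..n}) (N \<union> set Ms)"
    and len: "length Ms = k" and disj: "N \<inter> set Ms = {}"
    and nc: "\<And>A B. A \<in> N \<Longrightarrow> B \<in> N \<Longrightarrow> A \<noteq> B \<Longrightarrow> \<not> crosses A B"
    and cov: "\<And>A B. A \<in> N \<Longrightarrow> B \<in> set Ms \<Longrightarrow> \<not> covers A B"
    and sorted: "sorted_wrt right_of Ms"
    using Y' by (auto simp: configs_def atLeastAtMostSuc_conv)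
  have meet: "A = B" if "A \<in> N \<union> set Ms" "B \<in> N \<union> set Ms" "a \<in> A" "a \<in> B" for A B a
    using part that unfolding partition_on_def disjoint_def by blast
  have le: "a \<le> ?x" if "A \<in> N \<union> set Ms" "a \<in> A" for A a
    using configs_block(2)[OF Y' that(1)] that(2) by auto
  obtain A where A: "A \<in> N \<union> set Ms" "?x \<in> A"
    using part unfolding partition_on_def by blast
  have lt: "a < ?x" if "B \<in> N \<union> set Ms" "a \<in> B" "B \<noteq> A" for B a
    using le[OF that(1,2)] meet[OF that(1) A(1)] A(2) that by (cases "a = ?x") auto
  show thesis
  proof (cases "A \<in> N")
    case True
    show thesis
    proof (cases "A = {?x}")
      case single: True
      have "N \<union> set Ms - {{?x}} = (N - {{?x}}) \<union> set Ms"
        using True single disj by auto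
      then have "partition_on {1..n} ((N - {{?x}}) \<union> set Ms)"
        using partition_on_remove_singleton[OF part] True single by auto
      then have "(N - {A}, Ms) \<in> configs n k"
        using single len disj nc cov sorted by (auto simp: configs_def)
      moreover have "Y = add_closed ?x (N - {A}, Ms)"
        using True single Y by auto
      ultimately show thesis by (rule closed)
    next
      case False
      let ?L = "A - {?x}"
      have L: "?L \<noteq> {}" using False A by auto
      have "insert ?L (N \<union> set Ms - {A}) = (N - {A}) \<union> set (?L # Ms)"
        using True disj by auto
      then have "partition_on {1..n} ((N - {A}) \<union> set (?L # Ms))"
        using partition_on_remove_from_block[OF part A(1,2) False] by simp
      moreover have "?L \<notin> N"
        using L meet[OF A(1), of ?L] A(2) by blast
      \<comment> \<open>The last column lies in \<open>A\<close> and beyond \<open>B\<close>, so it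
        serves as the fourth point of a crossing of \<open>B\<close> and \<open>A\<close>.\<close>
      moreover have "\<not> covers B ?L" if "B \<in> N" "B \<noteq> A" for B
        using nc[OF that(1) True that(2)] lt[of B] that A(2)
        unfolding covers_def crosses_def by (metis Diff_iff UnI1)
      \<comment> \<open>Otherwise a point of \<open>B\<close> would lie between a point of
        \<open>A\<close> and the last column, which is in \<open>A\<close> too.\<close>
      moreover have "right_of ?L B" if B: "B \<in> set Ms" for B
        unfolding right_of_def
      proof (intro ballI)
        fix a b assume ab: "a \<in> ?L" "b \<in> B"
        have "B \<noteq> A" using B True disj by auto
        then have "b < ?x" "b \<noteq> a" using lt[of B b] meet[OF A(1), of B a] B ab by auto
        then show "b < a"
          using cov[OF True B] A(2) ab unfolding covers_def by (metis Diff_iff linorder_neqE_nat)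
      qed
      ultimately have "(N - {A}, ?L # Ms) \<in> configs n (Suc k)"
        using len disj nc cov sorted by (auto simp: configs_def)
      moreover have "Y = close_top ?x (N - {A}, ?L # Ms)"
        using True A(2) Y by (auto simp: insert_absorb)
      ultimately show thesis by (rule closing)
    qed
  next
    case False
    then have "A \<in> set Ms" using A by simp
    then obtain B Ms' where Ms: "Ms = B # Ms'" by (cases Ms) auto
    obtain b where "b \<in> B" using configs_block(1)[OF Y', of B] Ms by auto
    \<comment> \<open>If \<open>A\<close> were further down the stack, the head would lie to the
      right of the last column.\<close>
    then have AB: "B = A"
      using sorted \<open>A \<in> set Ms\<close> A(2) le[of B b] unfolding Ms
      by (fastforce simp: right_of_def)
    have A': "A \<notin> set Ms'" using configs_hd_notin_tl Y' Ms AB by blast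
    obtain j where k: "k = Suc j" using len Ms by (cases k) auto
    show thesis
    proof (cases "A = {?x}")
      case single: True
      have "N \<union> set Ms - {{?x}} = N \<union> set Ms'"
        using False single A' Ms AB by auto
      then have "partition_on {1..n} (N \<union> set Ms')"
        using partition_on_remove_singleton[OF part] A single by auto
      then have "(N, Ms') \<in> configs n j"
        using Ms k len disj nc cov sorted by (auto simp: configs_def)
      moreover have "Y = add_open ?x (N, Ms')"
        using single Y Ms AB by auto
      ultimately show thesis by (rule opened[OF k])
    next
      case notsingle: False
      let ?L = "A - {?x}"
      have L: "?L \<noteq> {}" using notsingle A by auto
      have "insert ?L (N \<union> set Ms - {A}) = N \<union> set (?L # Ms')"
        using False A' Ms AB by auto
      then have "partition_on {1..n} (N \<union> set (?L # Ms'))"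
        using partition_on_remove_from_block[OF part A(1,2) notsingle] by simp
      moreover have "?L \<notin> N"
        using L meet[OF A(1), of ?L] A(2) by blast
      moreover have "\<not> covers B ?L" if "B \<in> N" for B
        using cov[OF that \<open>A \<in> set Ms\<close>] unfolding covers_def by auto
      moreover have "right_of ?L B" if "B \<in> set Ms'" for B
        using sorted that unfolding Ms AB right_of_def by auto
      ultimately have "(N, ?L # Ms') \<in> configs n k"
        using Ms len disj nc cov sorted by (auto simp: configs_def)
      moreover have "Y = extend_top ?x (N, ?L # Ms')"
        using Y Ms AB A(2) by (auto simp: insert_absorb)
      ultimately show thesis by (rule extended[OF k])
    qed
  qed
qed

section \<open>The moves are injective with disjoint images\<close>

lemma configs_Suc_0:
  "configs (Suc n) 0 = add_closed (Suc n) ` configs n 0 \<union> close_top (Suc n) ` configs n 1"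
proof (intro equalityI subsetI)
  fix Y assume "Y \<in> configs (Suc n) 0"
  then show "Y \<in> add_closed (Suc n) ` configs n 0 \<union> close_top (Suc n) ` configs n 1"
    by (cases rule: configs_Suc_cases) auto
qed (use add_closed_configs close_top_configs in auto)

lemma configs_Suc_Suc:
  "configs (Suc n) (Suc k) =
     (add_closed (Suc n) ` configs n (Suc k) \<union> close_top (Suc n) ` configs n (Suc (Suc k))) \<union>
     (add_open (Suc n) ` configs n k \<union> extend_top (Suc n) ` configs n (Suc k))" (is "_ = ?R")
proof (intro equalityI subsetI)
  fix Y assume "Y \<in> configs (Suc n) (Suc k)"
  then show "Y \<in> ?R"
    by (cases rule: configs_Suc_cases) auto
qed (use add_closed_configs close_top_configs add_open_configs extend_top_configs in blast)

lemma finite_configs: "finite (configs n k)"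
proof (induction n arbitrary: k)
  case 0
  then show ?case by (simp add: configs_0)
next
  case (Suc n)
  then show ?case by (cases k) (simp_all add: configs_Suc_0 configs_Suc_Suc)
qed

text \<open>The point \<open>x\<close> singles out the inserted set; it will be the new column
  \<open>Suc n\<close>.\<close>

lemma insert_eq_insertD:
  assumes "insert A N = insert A' N'" "x \<in> A" "x \<in> A'" "\<forall>B\<in>N \<union> N'. x \<notin> B"
  shows "A = A'" "N = N'"
  using assms by blast+

lemma inj_on_add_closed: "inj_on (add_closed (Suc n)) (configs n k)"
proof (rule inj_onI, clarify)
  fix N Ms N' Ms'
  assume X: "(N, Ms) \<in> configs n k" "(N', Ms') \<in> configs n k"
    and eq: "add_closed (Suc n) (N, Ms) = add_closed (Suc n) (N', Ms')"
  show "N = N' \<and> Ms = Ms'"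
    using eq insert_eq_insertD(2)[of "{Suc n}" N "{Suc n}" N' "Suc n"]
      configs_block(3)[OF X(1)] configs_block(3)[OF X(2)] by auto
qed

lemma inj_on_add_open: "inj_on (add_open (Suc n)) (configs n k)"
  by (rule inj_onI) auto

lemma inj_on_extend_top: "inj_on (extend_top (Suc n)) (configs n (Suc k))"
proof (rule inj_onI)
  fix X X'
  assume *: "X \<in> configs n (Suc k)" "X' \<in> configs n (Suc k)"
    and eq: "extend_top (Suc n) X = extend_top (Suc n) X'"
  obtain N L Ms where X: "X = (N, L # Ms)" "(N, L # Ms) \<in> configs n (Suc k)"
    using *(1) by (rule configs_SucE)
  obtain N' L' Ms' where X': "X' = (N', L' # Ms')" "(N', L' # Ms') \<in> configs n (Suc k)"
    using *(2) by (rule configs_SucE)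
  have "Suc n \<notin> L" "Suc n \<notin> L'"
    using configs_block(3)[OF X(2)] configs_block(3)[OF X'(2)] by auto
  then show "X = X'" using eq X X' by (auto simp: insert_ident)
qed

text \<open>The block just closed is recognisable as the only set in the first component containing
  \<open>Suc n\<close>.\<close>

lemma inj_on_close_top: "inj_on (close_top (Suc n)) (configs n (Suc k))"
proof (rule inj_onI)
  fix X X'
  assume *: "X \<in> configs n (Suc k)" "X' \<in> configs n (Suc k)"
    and eq: "close_top (Suc n) X = close_top (Suc n) X'"
  obtain N L Ms where X: "X = (N, L # Ms)" "(N, L # Ms) \<in> configs n (Suc k)"
    using *(1) by (rule configs_SucE)
  obtain N' L' Ms' where X': "X' = (N', L' # Ms')" "(N', L' # Ms') \<in> configs n (Suc k)"
    using *(2) by (rule configs_SucE)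
  note notin = configs_block(3)[OF X(2)] configs_block(3)[OF X'(2)]
  have "insert (insert (Suc n) L) N = insert (insert (Suc n) L') N'"
    using eq X X' by simp
  then have "insert (Suc n) L = insert (Suc n) L'" "N = N'"
    using insert_eq_insertD[of "insert (Suc n) L" N "insert (Suc n) L'" N' "Suc n"] notin by auto
  moreover have "Suc n \<notin> L" "Suc n \<notin> L'" using notin by auto
  ultimately show "X = X'" using eq X X' by (auto simp: insert_ident)
qed

text \<open>The closed set containing \<open>Suc n\<close> is a singleton after the first move and
  has further points after the second.\<close>

lemma add_closed_close_top_disjoint:
  "add_closed (Suc n) ` configs n k \<inter> close_top (Suc n) ` configs n (Suc j) = {}"
proof -
  have False if conf: "X \<in> configs n k" "X' \<in> configs n (Suc j)"
    and eq: "add_closed (Suc n) X = close_top (Suc n) X'" for X X'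
  proof -
    obtain N Ms where X: "X = (N, Ms)" by (cases X)
    obtain N' L' Ms' where X': "X' = (N', L' # Ms')" "(N', L' # Ms') \<in> configs n (Suc j)"
      using conf(2) by (rule configs_SucE)
    note block = configs_block[OF conf(1)[unfolded X]] configs_block[OF X'(2)]
    have "insert {Suc n} N = insert (insert (Suc n) L') N'" using eq X X' by simp
    then have "{Suc n} \<in> insert (insert (Suc n) L') N'" by blast
    moreover have "{Suc n} \<notin> N'" using block(6)[of "{Suc n}"] by auto
    ultimately have "{Suc n} = insert (Suc n) L'" by blast
    moreover have "L' \<noteq> {}" "Suc n \<notin> L'" using block by auto
    ultimately show False by blast
  qed
  then show ?thesis by blast
qed

lemma add_open_extend_top_disjoint:
  "add_open (Suc n) ` configs n k \<inter> extend_top (Suc n) ` configs n (Suc j) = {}"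
proof -
  have False if conf: "X \<in> configs n k" "X' \<in> configs n (Suc j)"
    and eq: "add_open (Suc n) X = extend_top (Suc n) X'" for X X'
  proof -
    obtain N Ms where X: "X = (N, Ms)" by (cases X)
    obtain N' L' Ms' where X': "X' = (N', L' # Ms')" "(N', L' # Ms') \<in> configs n (Suc j)"
      using conf(2) by (rule configs_SucE)
    have "{Suc n} = insert (Suc n) L'" using eq X X' by simp
    moreover have "L' \<noteq> {}" "Suc n \<notin> L'" using configs_block[OF X'(2)] by auto
    ultimately show False by blast
  qed
  then show ?thesis by blast
qed

text \<open>Whether \<open>Suc n\<close> occurs in the first component tells the two groups of moves
  apart.\<close>

lemma closed_open_disjoint:
  "(add_closed (Suc n) ` configs n k \<union> close_top (Suc n) ` configs n k') \<inter>
   (add_open (Suc n) ` configs n j \<union> extend_top (Suc n) ` configs n j') = {}"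
proof -
  have "\<exists>A\<in>fst Y. Suc n \<in> A"
    if "Y \<in> add_closed (Suc n) ` configs n k \<union> close_top (Suc n) ` configs n k'" for Y
    using that by auto
  moreover have "\<forall>A\<in>fst Y. Suc n \<notin> A"
    if "Y \<in> add_open (Suc n) ` configs n j \<union> extend_top (Suc n) ` configs n j'" for Y
    using that configs_block(3) by fastforce
  ultimately show ?thesis by blast
qed

section \<open>Recurrence, binomial formula and Catalan numbers\<close>

lemma card_configs_Suc_0: "card (configs (Suc n) 0) = card (configs n 0) + card (configs n 1)"
  unfolding configs_Suc_0
  by (simp add: card_Un_disjoint finite_configs add_closed_close_top_disjoint card_image
      inj_on_add_closed inj_on_close_top)

text \<open>The factor 2 arises because both \<open>add_closed\<close> and \<open>extend_top\<close>
  keep the number of open blocks.\<close>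

lemma card_configs_Suc_Suc:
  "card (configs (Suc n) (Suc k)) =
     card (configs n k) + 2 * card (configs n (Suc k)) + card (configs n (Suc (Suc k)))"
  unfolding configs_Suc_Suc
  by (simp add: card_Un_disjoint finite_configs add_closed_close_top_disjoint closed_open_disjoint
      add_open_extend_top_disjoint card_image
      inj_on_add_closed inj_on_close_top inj_on_add_open inj_on_extend_top)

text \<open>Ballot numbers, written without subtraction. The recurrence for positive
  \<open>k\<close> is Pascal's rule applied twice.\<close>

lemma card_configs: "card (configs n k) + (2 * n choose (n + k + 1)) = (2 * n choose (n + k))"
proof (induction n arbitrary: k)
  case 0
  then show ?case by (simp add: configs_0)
next
  case (Suc n)
  show ?case
  proof (cases k)
    case 0
    \<comment> \<open>At the boundary \<open>k = 0\<close> the recurrence has another shape, and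
      symmetry of the binomial coefficients makes up for it: the formula continued to
      \<open>k = -1\<close> is the negative of its value at \<open>k = 0\<close>.\<close>
    have "(Suc (2 * n) choose n) = (Suc (2 * n) choose Suc n)"
      using binomial_symmetric[of n "Suc (2 * n)"] by simp
    then show ?thesis
      using Suc.IH[of 0] Suc.IH[of 1] 0 by (simp add: card_configs_Suc_0)
  next
    case (Suc j)
    then show ?thesis
      using Suc.IH[of j] Suc.IH[of "Suc j"] Suc.IH[of "Suc (Suc j)"]
      by (simp add: card_configs_Suc_Suc)
  qed
qed

lemma catalan_eq_card_configs: "catalan m = real (card (configs m 0))"
proof -
  \<comment> \<open>Both sides equal \<open>2 * m * (2 * m - 1 choose m)\<close>.\<close>
  have "(2 * m choose m) * m = (2 * m choose Suc m) * Suc m"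
    using binomial_absorb_comp[of "2 * m" m] binomial_absorption[of m "2 * m"]
    by (simp del: binomial_Suc_Suc add: mult.commute)
  then have "real ((2 * m choose m) * m) = real ((2 * m choose Suc m) * Suc m)"
    by (rule arg_cong)
  then have 1: "real (2 * m choose m) * real m = real (2 * m choose Suc m) * (real m + 1)"
    by (simp only: of_nat_mult of_nat_Suc add.commute)
  have "real (card (configs m 0) + (2 * m choose Suc m)) = real (2 * m choose m)"
    using card_configs[of m 0] by simp
  then have 2: "real (2 * m choose Suc m) = real (2 * m choose m) - real (card (configs m 0))"
    by (simp only: of_nat_add)
  have "real (card (configs m 0)) * (real m + 1) = real (2 * m choose m)"
    using 1 unfolding 2 by (simp only: algebra_simps)
  moreover have "real m + 1 \<noteq> 0" by linarith
  ultimately show ?thesis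
    unfolding catalan_def by (metis mult.left_neutral nonzero_eq_divide_eq times_divide_eq_left)
qed

text \<open>With \<open>t k\<close> for the cardinality of \<open>configs n k\<close>, the
  recurrence gives \<open>t 0 + t 1\<close> at \<open>n + 1\<close> and
  \<open>2 * t 0 + 3 * t 1 + t 2\<close> at \<open>n + 2\<close>.\<close>

lemma card_configs_le_2:
  "real (\<Sum>k\<le>2. card (configs n k)) = catalan (n + 2) - 2 * catalan (n + 1) + catalan n"
  by (simp add: catalan_eq_card_configs card_configs_Suc_0 card_configs_Suc_Suc numeral_2_eq_2)

subsection \<open>Symmetric planar partitions\<close>

definition to_partition :: "nat set set \<times> nat set list \<Rightarrow> vertex set set" where
  "to_partition X = (\<lambda>A. Upper ` A) ` fst X \<union> (\<lambda>A. Lower ` A) ` fst X \<union>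
     (\<lambda>A. Upper ` A \<union> Lower ` A) ` set (snd X)"

lemma to_partition_cases:
  assumes "B \<in> to_partition (N, Ms)"
  obtains A where "A \<in> N" "B = Upper ` A" | A where "A \<in> N" "B = Lower ` A"
  | A where "A \<in> set Ms" "B = Upper ` A \<union> Lower ` A"
  using assms by (auto simp: to_partition_def)

lemma vertices_eq: "vertices n = Upper ` {1..n} \<union> Lower ` {1..n}"
  by (simp add: vertices_def upper_row_def lower_row_def)

lemma vertex_image_simps [simp]:
  "Upper ` A = Upper ` A' \<longleftrightarrow> A = A'" "Lower ` A = Lower ` A' \<longleftrightarrow> A = A'"
  "Upper ` A \<union> Lower ` C = Upper ` A' \<union> Lower ` C' \<longleftrightarrow> A = A' \<and> C = C'"
  by (auto simp: set_eq_iff)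

lemma partition_on_to_partition:
  assumes "partition_on {1..n} (N \<union> set Ms)" "N \<inter> set Ms = {}"
  shows "partition_on (vertices n) (to_partition (N, Ms))"
proof -
  let ?P = "N \<union> set Ms"
  have meet: "A = B" if "A \<in> ?P" "B \<in> ?P" "a \<in> A" "a \<in> B" for A B a
    using assms(1) that unfolding partition_on_def disjoint_def by blast
  have ne: "{} \<notin> ?P" and U: "\<Union>?P = {1..n}" using assms(1) by (auto simp: partition_on_def)
  show ?thesis
  proof (rule partition_onI)
    have "\<Union>(to_partition (N, Ms)) = Upper ` \<Union>?P \<union> Lower ` \<Union>?P"
      unfolding to_partition_def by auto
    then show "\<Union>(to_partition (N, Ms)) = vertices n" unfolding U vertices_eq .
    show "{} \<notin> to_partition (N, Ms)" using ne by (auto simp: to_partition_def)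
    \<comment> \<open>A block is determined by any one of its vertices: the index gives the set
      \<open>A\<close>, and the row decides between the two copies unless \<open>A\<close> is
      transversal.\<close>
    have block: "B = (if A \<in> set Ms then Upper ` A \<union> Lower ` A else if v = Upper i then Upper ` A else Lower ` A)"
      if B: "B \<in> to_partition (N, Ms)" and v: "v \<in> B" "v = Upper i \<or> v = Lower i"
        and A: "A \<in> ?P" "i \<in> A" for B v i A
      using B
    proof (cases rule: to_partition_cases)
      case (1 A')
      then have "i \<in> A'" "v = Upper i" using v by auto
      then show ?thesis using 1 meet[of A' A i] A assms(2) by auto
    next
      case (2 A')
      then have "i \<in> A'" "v = Lower i" using v by auto
      then show ?thesis using 2 meet[of A' A i] A assms(2) by auto
    next
      case (3 A')
      then have "i \<in> A'" using v by auto
      then show ?thesis using 3 meet[of A' A i] A by auto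
    qed
    have "B = C"
      if BC: "B \<in> to_partition (N, Ms)" "C \<in> to_partition (N, Ms)" "v \<in> B" "v \<in> C" for B C v
    proof -
      obtain A i where "A \<in> ?P" "i \<in> A" "v = Upper i \<or> v = Lower i"
        using BC(1,3) unfolding to_partition_def by auto
      then show ?thesis using block[of B v i A] block[of C v i A] BC by simp
    qed
    then show "disjnt B C" if "B \<in> to_partition (N, Ms)" "C \<in> to_partition (N, Ms)" "B \<noteq> C" for B C
      using that unfolding disjnt_def by blast
  qed
qed

lemma swap_rows_image: "swap_rows ` (Upper ` A \<union> Lower ` C) = Upper ` C \<union> Lower ` A"
  by (auto simp: image_Un image_image)

section \<open>Symmetry, planarity and rank of the image\<close>

lemma pstar_to_partition: "pstar (to_partition X) = to_partition X"
  by (auto simp: pstar_def rename_def to_partition_def image_Un image_image Un_commute)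

text \<open>Planarity will be checked by refuting one of these two weaker three-point
  patterns.\<close>

lemma blocks_cross_between:
  assumes "blocks_cross n B C"
  shows "\<exists>u\<in>B. \<exists>v\<in>C. \<exists>w\<in>B. boundary_pos n u < boundary_pos n v \<and> boundary_pos n v < boundary_pos n w"
    and "\<exists>u\<in>C. \<exists>v\<in>B. \<exists>w\<in>C. boundary_pos n u < boundary_pos n v \<and> boundary_pos n v < boundary_pos n w"
  using assms unfolding blocks_cross_def by blast+

text \<open>The whole upper row precedes the lower row on the boundary, so a vertex between two
  upper ones is itself upper.\<close>

lemma upper_between_covers:
  assumes "u \<in> Upper ` A" "v \<in> Upper ` C \<union> Lower ` C" "w \<in> Upper ` A"
    "boundary_pos n u < boundary_pos n v" "boundary_pos n v < boundary_pos n w"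
    "A \<subseteq> {1..n}" "C \<subseteq> {1..n}"
  shows "covers A C"
proof -
  obtain a c where ac: "a \<in> A" "u = Upper a" "c \<in> A" "w = Upper c" using assms(1,3) by blast
  consider b where "b \<in> C" "v = Upper b" | b where "b \<in> C" "v = Lower b" using assms(2) by blast
  then show ?thesis
  proof cases
    case 1
    then have "a < b" "b < c" using ac assms(4,5) by simp_all
    then show ?thesis using ac 1 unfolding covers_def by blast
  next
    case 2
    then have "b \<le> n" "c \<le> n" using ac assms(6,7) by auto
    then show ?thesis using ac 2 assms(5) by simp
  qed
qed

lemma lower_between_covers:
  assumes "u \<in> Lower ` A" "v \<in> Upper ` C \<union> Lower ` C" "w \<in> Lower ` A"
    "boundary_pos n u < boundary_pos n v" "boundary_pos n v < boundary_pos n w"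
    "A \<subseteq> {1..n}" "C \<subseteq> {1..n}"
  shows "covers A C"
proof -
  obtain a c where ac: "a \<in> A" "u = Lower a" "c \<in> A" "w = Lower c" using assms(1,3) by blast
  consider b where "b \<in> C" "v = Upper b" | b where "b \<in> C" "v = Lower b" using assms(2) by blast
  then show ?thesis
  proof cases
    case 1
    then have "b \<le> n" "a \<le> n" using ac assms(6,7) by auto
    then show ?thesis using ac 1 assms(4) by simp
  next
    case 2
    then have "c < b" "b < a" using ac assms(4,5) by simp_all
    then show ?thesis using ac 2 unfolding covers_def by blast
  qed
qed

text \<open>The vertices over \<open>A\<close> occupy a middle stretch of the boundary order, and
  those over \<open>C\<close> lie before or after that stretch.\<close>

lemma right_of_not_between:
  assumes "right_of A C" "u \<in> Upper ` A \<union> Lower ` A" "v \<in> Upper ` C \<union> Lower ` C"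
    "w \<in> Upper ` A \<union> Lower ` A" "A \<subseteq> {1..n}" "C \<subseteq> {1..n}"
  shows "\<not> (boundary_pos n u < boundary_pos n v \<and> boundary_pos n v < boundary_pos n w)"
proof -
  obtain a where a: "a \<in> A" "u = Upper a \<or> u = Lower a" using assms(2) by blast
  obtain b where b: "b \<in> C" "v = Upper b \<or> v = Lower b" using assms(3) by blast
  obtain c where c: "c \<in> A" "w = Upper c \<or> w = Lower c" using assms(4) by blast
  have "b < a" "b < c" using assms(1) a b c by (auto simp: right_of_def)
  moreover have "a \<le> n" "c \<le> n" using a c assms(5) by auto
  ultimately show ?thesis using a(2) b(2) c(2) by (elim disjE) simp_all
qed

lemma not_blocks_cross_rows:
  assumes "A \<subseteq> {1..n}" "C \<subseteq> {1..n}"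
  shows "\<not> blocks_cross n (Upper ` A) (Lower ` C)" "\<not> blocks_cross n (Lower ` A) (Upper ` C)"
proof -
  have "\<not> boundary_pos n (Lower c) < boundary_pos n (Upper a)" if "a \<in> {1..n}" "c \<in> {1..n}" for a c
    using that by simp
  then show "\<not> blocks_cross n (Upper ` A) (Lower ` C)" "\<not> blocks_cross n (Lower ` A) (Upper ` C)"
    using assms unfolding blocks_cross_def by blast+
qed

lemma blocks_cross_Upper: "blocks_cross n (Upper ` A) (Upper ` C) \<Longrightarrow> crosses A C"
  by (simp add: blocks_cross_def crosses_def)

text \<open>Boundary positions decrease along the lower row; reading the pattern backwards exchanges
  the two sets.\<close>

lemma blocks_cross_Lower: "blocks_cross n (Lower ` A) (Lower ` C) \<Longrightarrow> crosses C A"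
  unfolding blocks_cross_def crosses_def by simp blast

text \<open>Blocks in different rows never cross, and those in the same row reduce to
  \<open>crosses\<close>. A transversal block against another one is settled by
  \<open>covers\<close>, and two transversal blocks by \<open>right_of\<close>.\<close>

lemma planar_to_partition:
  assumes "(N, Ms) \<in> configs n k"
  shows "planar n (to_partition (N, Ms))"
  unfolding planar_def
proof (intro ballI impI notI)
  fix B C
  assume B: "B \<in> to_partition (N, Ms)" and C: "C \<in> to_partition (N, Ms)"
    and BC: "B \<noteq> C" and cross: "blocks_cross n B C"
  have range: "A \<subseteq> {1..n}" if "A \<in> N \<union> set Ms" for A
    using configs_block(2)[OF assms that(1)] .
  have nc: "\<not> crosses A A'" if "A \<in> N" "A' \<in> N" "A \<noteq> A'" for A A'
    using assms that by (auto simp: configs_def)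
  have cov: "\<not> covers A A'" if "A \<in> N" "A' \<in> set Ms" for A A'
    using assms that by (auto simp: configs_def)
  have sep: "right_of A A' \<or> right_of A' A" if "A \<in> set Ms" "A' \<in> set Ms" "A \<noteq> A'" for A A'
  proof -
    have "sorted_wrt right_of Ms" using assms by (simp add: configs_def)
    then show ?thesis using that by (induction Ms) auto
  qed
  note between = blocks_cross_between[OF cross]
  show False
    using B
  proof (cases rule: to_partition_cases)
    case B: (1 A)
    from C show ?thesis
    proof (cases rule: to_partition_cases)
      case (1 A')
      then show ?thesis using B BC nc[of A A'] blocks_cross_Upper cross by blast
    next
      case (2 A')
      then show ?thesis using B not_blocks_cross_rows(1) range cross by blast
    next
      case (3 A')
      then show ?thesis
        using B between(1) upper_between_covers range cov[of A A'] by (metis UnCI)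
    qed
  next
    case B: (2 A)
    from C show ?thesis
    proof (cases rule: to_partition_cases)
      case (1 A')
      then show ?thesis using B not_blocks_cross_rows(2) range cross by blast
    next
      case (2 A')
      then show ?thesis using B BC nc[of A' A] blocks_cross_Lower cross by blast
    next
      case (3 A')
      then show ?thesis
        using B between(1) lower_between_covers range cov[of A A'] by (metis UnCI)
    qed
  next
    case B: (3 A)
    from C show ?thesis
    proof (cases rule: to_partition_cases)
      case (1 A')
      then show ?thesis
        using B between(2) upper_between_covers range cov[of A' A] by (metis UnCI)
    next
      case (2 A')
      then show ?thesis
        using B between(2) lower_between_covers range cov[of A' A] by (metis UnCI)
    next
      case (3 A')
      then consider "right_of A A'" | "right_of A' A" using sep[of A A'] B BC by blast
      then show ?thesis
      proof cases
        case 1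
        then show ?thesis
          using between(1) right_of_not_between[OF 1] range[of A] range[of A'] B 3 by blast
      next
        case 2
        then show ?thesis
          using between(2) right_of_not_between[OF 2] range[of A] range[of A'] B 3 by blast
      qed
    qed
  qed
qed

lemma prank_to_partition:
  assumes "(N, Ms) \<in> configs n k"
  shows "prank n (to_partition (N, Ms)) = k"
proof -
  have block: "A \<noteq> {}" "A \<subseteq> {1..n}" if "A \<in> N \<union> set Ms" for A
    using configs_block[OF assms that] by auto
  have "{B \<in> to_partition (N, Ms). B \<inter> upper_row n \<noteq> {} \<and> B \<inter> lower_row n \<noteq> {}} =
      (\<lambda>A. Upper ` A \<union> Lower ` A) ` set Ms" (is "?L = ?R")
  proof (intro equalityI subsetI)
    fix B assume B: "B \<in> ?L"
    then have "B \<in> to_partition (N, Ms)" by simp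
    then show "B \<in> ?R"
      by (cases rule: to_partition_cases) (use B in \<open>auto simp: upper_row_def lower_row_def\<close>)
  next
    fix B assume "B \<in> ?R"
    then obtain A where A: "A \<in> set Ms" "B = Upper ` A \<union> Lower ` A" by blast
    then obtain a where "a \<in> A" "a \<in> {1..n}" using block[of A] by blast
    then show "B \<in> ?L"
      using A by (auto simp: to_partition_def upper_row_def lower_row_def)
  qed
  moreover have "inj_on (\<lambda>A. Upper ` A \<union> Lower ` A) (set Ms)"
    by (rule inj_onI) simp
  \<comment> \<open>The rank counts a set of blocks while \<open>k\<close> is the length of a list,
    so repetitions must be ruled out.\<close>
  moreover have "distinct Ms"
  proof -
    have "sorted_wrt right_of Ms" using assms by (simp add: configs_def)
    moreover have "\<not> right_of A A" if "A \<in> set Ms" for A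
      using block(1)[of A] that by (auto simp: right_of_def)
    ultimately show ?thesis
      by (induction Ms) auto
  qed
  moreover have "length Ms = k" using assms by (simp add: configs_def)
  ultimately show ?thesis
    by (simp add: prank_def card_image distinct_card)
qed

section \<open>Idempotency\<close>

lemma equivclp_invariant:
  assumes "equivclp r x y" "\<And>x y. r x y \<Longrightarrow> f x = f y"
  shows "f x = f y"
  using assms(1) by (induction rule: equivclp_induct) (use assms(2) in metis)+

text \<open>The invariant attached to a vertex is its block in the set \<open>N \<union> set Ms\<close> together with its row,
  the row being forgotten when the block is transversal.\<close>

lemma pmult_to_partition:
  assumes P: "partition_on {1..n} (N \<union> set Ms)" and disj: "N \<inter> set Ms = {}"
  shows "pmult n (to_partition (N, Ms)) (to_partition (N, Ms)) = to_partition (N, Ms)"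
proof -
  let ?\<alpha> = "to_partition (N, Ms)"
  define blk where "blk i = (THE A. A \<in> N \<union> set Ms \<and> i \<in> A)" for i
  have blk: "blk i = A" if "A \<in> N \<union> set Ms" "i \<in> A" for i A
    unfolding blk_def using P that unfolding partition_on_def disjoint_def by (intro the_equality) blast+
  \<comment> \<open>The values 1, 2 and 3 will stand for the upper, lower and middle row;
    transversal blocks get 0 in every row.\<close>
  define row :: "nat set \<Rightarrow> nat \<Rightarrow> nat" where "row A r = (if A \<in> N then r else 0)" for A r
  define lab where "lab v = (case v of Upper i \<Rightarrow> (blk i, row (blk i) 1)
     | Lower i \<Rightarrow> (blk i, row (blk i) 2) | Middle i \<Rightarrow> (blk i, row (blk i) 3))" for v
  define gen where "gen x y \<longleftrightarrow>
    (\<exists>B \<in> rename lower_to_middle ?\<alpha> \<union> rename upper_to_middle ?\<alpha>. x \<in> B \<and> y \<in> B)" for x y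
  have row: "row A r = row A s" if "A \<in> set Ms" for A r s
    using that disj by (auto simp: row_def)
  have gen_lab: "lab x = lab y" if "gen x y" for x y
  proof -
    from that obtain B f where B: "B \<in> ?\<alpha>" and f: "f = lower_to_middle \<or> f = upper_to_middle"
      and xy: "x \<in> f ` B" "y \<in> f ` B"
      unfolding gen_def rename_def by blast
    from B show ?thesis
    proof (cases rule: to_partition_cases)
      case (1 A)
      then show ?thesis using f xy blk[of A] by (auto simp: lab_def)
    next
      case (2 A)
      then show ?thesis using f xy blk[of A] by (auto simp: lab_def)
    next
      case (3 A)
      then show ?thesis using f xy blk[of A] row[of A] by (auto simp: lab_def)
    qed
  qed
  have "product_rel ?\<alpha> ?\<alpha> x y \<longleftrightarrow> (\<exists>B\<in>?\<alpha>. x \<in> B \<and> y \<in> B)"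
    if x: "x \<in> vertices n" and y: "y \<in> vertices n" for x y
  proof
    assume "product_rel ?\<alpha> ?\<alpha> x y"
    \<comment> \<open>The label is constant on generating pairs, hence on the classes of the
      generated equivalence.\<close>
    then have eq: "lab x = lab y"
      unfolding product_rel_def using equivclp_invariant[of _ x y lab] gen_lab
      unfolding gen_def by blast
    obtain i where i: "x = Upper i \<or> x = Lower i" "i \<in> {1..n}" using x by (auto simp: vertices_eq)
    obtain j where j: "y = Upper j \<or> y = Lower j" "j \<in> {1..n}" using y by (auto simp: vertices_eq)
    have "blk i = blk j" using eq i j by (auto simp: lab_def)
    moreover obtain A where A: "A \<in> N \<union> set Ms" "i \<in> A"
      using i(2) P unfolding partition_on_def by blast
    moreover obtain A' where A': "A' \<in> N \<union> set Ms" "j \<in> A'"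
      using j(2) P unfolding partition_on_def by blast
    ultimately have "j \<in> A" "blk i = A" "blk j = A" using blk by auto
    then show "\<exists>B\<in>?\<alpha>. x \<in> B \<and> y \<in> B"
    proof (cases "A \<in> N")
      case True
      then have "x = Upper i \<and> y = Upper j \<or> x = Lower i \<and> y = Lower j"
        using i(1) j(1) eq \<open>blk i = A\<close> \<open>blk j = A\<close> by (auto simp: lab_def row_def)
      moreover have "Upper ` A \<in> ?\<alpha>" "Lower ` A \<in> ?\<alpha>"
        using True by (auto simp: to_partition_def)
      ultimately show ?thesis using A(2) \<open>j \<in> A\<close> by (metis imageI)
    next
      case False
      then have "Upper ` A \<union> Lower ` A \<in> ?\<alpha>" using A(1) by (auto simp: to_partition_def)
      moreover have "x \<in> Upper ` A \<union> Lower ` A" "y \<in> Upper ` A \<union> Lower ` A"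
        using A(2) \<open>j \<in> A\<close> i(1) j(1) by auto
      ultimately show ?thesis by (intro bexI conjI)
    qed
  next
    assume "\<exists>B\<in>?\<alpha>. x \<in> B \<and> y \<in> B"
    then obtain B where B: "B \<in> ?\<alpha>" "x \<in> B" "y \<in> B" by blast
    have gen: "equivclp gen (f a) (f b)" if "C \<in> ?\<alpha>" "a \<in> C" "b \<in> C"
      "f = lower_to_middle \<or> f = upper_to_middle" for C a b f
      using that by (intro r_into_equivclp) (auto simp: gen_def rename_def)
    have "equivclp gen x y"
      using B(1)
    proof (cases rule: to_partition_cases)
      case (1 A)
      then show ?thesis using B gen[of B x y lower_to_middle] by auto
    next
      case (2 A)
      then show ?thesis using B gen[of B x y upper_to_middle] by auto
    next
      case (3 A)
      have UMid: "equivclp gen (Upper i) (Middle j)" and UU: "equivclp gen (Upper i) (Upper j)"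
        and LL: "equivclp gen (Lower i) (Lower j)" and MidL: "equivclp gen (Middle i) (Lower j)"
        if "i \<in> A" "j \<in> A" for i j
      proof -
        have mem: "Upper i \<in> B" "Lower i \<in> B" "Upper j \<in> B" "Lower j \<in> B"
          using that 3(2) by auto
        show "equivclp gen (Upper i) (Middle j)" "equivclp gen (Upper i) (Upper j)"
          using gen[OF B(1) mem(1) mem(4), of lower_to_middle]
            gen[OF B(1) mem(1) mem(3), of lower_to_middle] by simp_all
        show "equivclp gen (Lower i) (Lower j)" "equivclp gen (Middle i) (Lower j)"
          using gen[OF B(1) mem(2) mem(4), of upper_to_middle]
            gen[OF B(1) mem(1) mem(4), of upper_to_middle] by simp_all
      qed
      \<comment> \<open>The first factor leads from the upper to the middle row, the second from the
        middle to the lower row.\<close>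
      have UL: "equivclp gen (Upper i) (Lower j)" if "i \<in> A" "j \<in> A" for i j
        using UMid[of i i] MidL[of i j] that by (blast intro: equivclp_trans)
      then show ?thesis
        using B(2,3) UU LL unfolding 3(2) by (auto intro: equivclp_sym)
    qed
    then show "product_rel ?\<alpha> ?\<alpha> x y"
      unfolding product_rel_def gen_def .
  qed
  then have "{(x, y). x \<in> vertices n \<and> y \<in> vertices n \<and> product_rel ?\<alpha> ?\<alpha> x y} =
      {(x, y). \<exists>B\<in>?\<alpha>. x \<in> B \<and> y \<in> B}"
    using partition_onD1[OF partition_on_to_partition[OF P disj]] by blast
  then show ?thesis
    unfolding pmult_def
    using partition_on_eq_quotient[OF partition_on_to_partition[OF P disj]] by simp
qed


section \<open>Injectivity of the encoding\<close>

lemma to_partition_mem: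
  assumes "A \<noteq> {}"
  shows "Upper ` A \<in> to_partition (N, Ms) \<longleftrightarrow> A \<in> N"
    and "Upper ` A \<union> Lower ` A \<in> to_partition (N, Ms) \<longleftrightarrow> A \<in> set Ms"
proof -
  obtain a where a: "a \<in> A" using assms by blast
  \<comment> \<open>An element of \<open>A\<close> is essential: for the empty set all three kinds
    of image coincide.\<close>
  have neq: "Upper ` A \<noteq> Lower ` C" "Upper ` A \<noteq> Upper ` C \<union> Lower ` C"
    "Upper ` A \<union> Lower ` A \<noteq> Upper ` C" "Upper ` A \<union> Lower ` A \<noteq> Lower ` C" for C
    using a by blast+
  show "Upper ` A \<in> to_partition (N, Ms) \<longleftrightarrow> A \<in> N"
  proof
    assume "Upper ` A \<in> to_partition (N, Ms)"
    then show "A \<in> N" by (cases rule: to_partition_cases) (use neq in simp_all)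
  qed (simp add: to_partition_def)
  show "Upper ` A \<union> Lower ` A \<in> to_partition (N, Ms) \<longleftrightarrow> A \<in> set Ms"
  proof
    assume "Upper ` A \<union> Lower ` A \<in> to_partition (N, Ms)"
    then show "A \<in> set Ms" by (cases rule: to_partition_cases) (use neq in simp_all)
  qed (simp add: to_partition_def)
qed

text \<open>Different heads would each have to be to the right of the other, which is impossible for
  nonempty sets.\<close>

lemma sorted_right_of_unique:
  assumes "sorted_wrt right_of xs" "sorted_wrt right_of ys" "set xs = set ys" "{} \<notin> set xs"
  shows "xs = ys"
  using assms
proof (induction xs arbitrary: ys)
  case Nil
  then show ?case by simp
next
  case (Cons x xs)
  then obtain y ys' where ys: "ys = y # ys'" by (cases ys) auto
  have asym: "\<not> right_of B A" if "right_of A B" "A \<noteq> {}" "B \<noteq> {}" for A B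
    using that by (fastforce simp: right_of_def)
  have ne: "A \<noteq> {}" if "A \<in> set (x # xs)" for A
    using Cons.prems(4) that by auto
  have xy: "x = y"
  proof (rule ccontr)
    assume "x \<noteq> y"
    then have "x \<in> set ys'" "y \<in> set xs" using Cons.prems(3) unfolding ys by auto
    then have "right_of y x" "right_of x y" using Cons.prems(1,2) unfolding ys by auto
    then show False using asym ne \<open>y \<in> set xs\<close> by auto
  qed
  have irr: "\<not> right_of A A" if "A \<in> set (x # xs)" for A
    using asym[of A A] ne[OF that] by blast
  have "x \<notin> set xs" "y \<notin> set ys'"
    using Cons.prems(1,2) irr[of x] unfolding ys xy by auto
  then have "set xs = set ys'" using Cons.prems(3) unfolding ys xy by auto
  then show ?case using Cons.IH[of ys'] Cons.prems ys xy by auto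
qed

text \<open>The union over \<open>k\<close> lets the encoding separate configurations with different
  numbers of open blocks as well.\<close>

lemma inj_on_to_partition: "inj_on to_partition (\<Union>k. configs n k)"
proof (rule inj_onI)
  fix X Y
  assume XY: "X \<in> (\<Union>k. configs n k)" "Y \<in> (\<Union>k. configs n k)" and eq: "to_partition X = to_partition Y"
  obtain N Ms where X0: "X = (N, Ms)" by (cases X)
  obtain N' Ms' where Y0: "Y = (N', Ms')" by (cases Y)
  obtain k l where X: "X = (N, Ms)" "(N, Ms) \<in> configs n k"
    and Y: "Y = (N', Ms')" "(N', Ms') \<in> configs n l"
    using XY X0 Y0 by blast
  note ne = configs_block(1)[OF X(2)] configs_block(1)[OF Y(2)]
  have mem: "A \<in> N \<longleftrightarrow> A \<in> N'" "A \<in> set Ms \<longleftrightarrow> A \<in> set Ms'" if "A \<noteq> {}" for A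
    using to_partition_mem[OF that, of N Ms] to_partition_mem[OF that, of N' Ms']
      eq[unfolded X(1) Y(1)] by simp_all
  have "A \<in> N \<longleftrightarrow> A \<in> N'" "A \<in> set Ms \<longleftrightarrow> A \<in> set Ms'" for A
    using mem[of A] ne[of "{}"] by (cases "A = {}"; blast)+
  then have "N = N'" "set Ms = set Ms'" by blast+
  moreover have "Ms = Ms'"
  proof (rule sorted_right_of_unique)
    show "sorted_wrt right_of Ms" "sorted_wrt right_of Ms'"
      using X(2) Y(2) by (simp_all add: configs_def)
    show "{} \<notin> set Ms" using ne(1)[of "{}"] by blast
  qed fact
  ultimately show "X = Y" using X Y by simp
qed

section \<open>Every symmetric planar partition is encoded\<close>

lemma exists_sorted_right_of:
  assumes "finite M" "{} \<notin> M" "\<And>A B. A \<in> M \<Longrightarrow> B \<in> M \<Longrightarrow> A \<noteq> B \<Longrightarrow> right_of A B \<or> right_of B A"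
  shows "\<exists>xs. set xs = M \<and> sorted_wrt right_of xs"
  using assms
proof (induction "card M" arbitrary: M)
  case 0
  then show ?case by (intro exI[of _ "[]"]) auto
next
  case (Suc k)
  have trans: "right_of A C" if AB: "right_of A B" and BC: "right_of B C" and B: "B \<in> M" for A B C
  proof -
    obtain b where "b \<in> B" using B Suc.prems(2) by fastforce
    then show ?thesis using AB BC unfolding right_of_def by (meson less_trans)
  qed
  \<comment> \<open>Each nonempty \<open>S \<subseteq> M\<close> has a rightmost member, by
    induction on \<open>S\<close>. For \<open>S = M\<close> it becomes the head of the list.\<close>
  have "\<exists>A\<in>S. \<forall>B\<in>S - {A}. right_of A B" if "S \<subseteq> M" "S \<noteq> {}" for S
  proof -
    have "finite S" using that Suc.prems(1) finite_subset by blast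
    then show ?thesis using that(2,1)
    proof (induction rule: finite_ne_induct)
      case (singleton x)
      then show ?case by simp
    next
      case (insert x F)
      then obtain A where A: "A \<in> F" "\<forall>B\<in>F - {A}. right_of A B" by auto
      have "A \<noteq> x" "A \<in> M" "x \<in> M" using A insert by auto
      then consider "right_of A x" | "right_of x A" using Suc.prems(3) by blast
      then show ?case
      proof cases
        case 1
        then show ?thesis using A by (intro bexI[of _ A]) auto
      next
        case 2
        then have "right_of x B" if "B \<in> F" for B
          using A that trans[of x A B] \<open>A \<in> M\<close> by (cases "B = A") auto
        then show ?thesis by (intro bexI[of _ x]) auto
      qed
    qed
  qed
  moreover have "M \<noteq> {}" using Suc.hyps(2) by auto
  ultimately obtain A where A: "A \<in> M" "\<forall>B\<in>M - {A}. right_of A B" by blast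
  have "k = card (M - {A})" using A(1) Suc.hyps(2) by simp
  then obtain xs where "set xs = M - {A}" "sorted_wrt right_of xs"
    using Suc.hyps(1)[of "M - {A}"] Suc.prems by auto
  then show ?case using A by (intro exI[of _ "A # xs"]) auto
qed

lemma blocks_crossI:
  assumes "a \<in> A" "b \<in> B" "c \<in> A" "d \<in> B" "boundary_pos n a < boundary_pos n b"
    "boundary_pos n b < boundary_pos n c" "boundary_pos n c < boundary_pos n d"
  shows "blocks_cross n A B"
  using assms unfolding blocks_cross_def by blast

lemma symmetric_planar_block:
  assumes part: "partition_on (vertices n) \<alpha>" and pl: "planar n \<alpha>" and sym: "\<alpha> = pstar \<alpha>"
    and B: "B \<in> \<alpha>"
  obtains A where "A \<noteq> {}" "A \<subseteq> {1..n}"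
    "B = Upper ` A \<and> Lower ` A \<in> \<alpha> \<or> B = Lower ` A \<and> Upper ` A \<in> \<alpha> \<or> B = Upper ` A \<union> Lower ` A"
proof -
  have sub: "B \<subseteq> Upper ` {1..n} \<union> Lower ` {1..n}" and ne: "B \<noteq> {}"
    using part B unfolding partition_on_def vertices_eq by blast+
  define A C where "A = {i. Upper i \<in> B}" and "C = {i. Lower i \<in> B}"
  have BAC: "B = Upper ` A \<union> Lower ` C" and range: "A \<subseteq> {1..n}" "C \<subseteq> {1..n}"
    using sub unfolding A_def C_def by auto
  have "swap_rows ` B \<in> pstar \<alpha>" using B by (auto simp: pstar_def rename_def)
  then have B': "Upper ` C \<union> Lower ` A \<in> \<alpha>" unfolding BAC swap_rows_image using sym by simp
  have "A = C" if "A \<noteq> {}" "C \<noteq> {}"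
  proof (rule ccontr)
    assume "A \<noteq> C"
    let ?B' = "Upper ` C \<union> Lower ` A"
    have neq: "B \<noteq> ?B'" using \<open>A \<noteq> C\<close> unfolding BAC by auto
    then have "B \<inter> ?B' = {}"
      using disjointD[OF partition_onD2[OF part] B B'] by simp
    moreover obtain a c where ac: "a \<in> A" "c \<in> C" using \<open>A \<noteq> {}\<close> \<open>C \<noteq> {}\<close> by blast
    ultimately have "a \<noteq> c" unfolding BAC by auto
    have "a \<in> {1..n}" "c \<in> {1..n}" using ac range by auto
    \<comment> \<open>For \<open>a < c\<close> the boundary order is \<open>Upper a\<close>,
      \<open>Upper c\<close>, \<open>Lower c\<close>, \<open>Lower a\<close>, alternating between
      \<open>B\<close> and its mirror image; for \<open>c < a\<close> the two blocks change
      roles.\<close>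
    then consider "blocks_cross n B ?B'" | "blocks_cross n ?B' B"
      using \<open>a \<noteq> c\<close> ac blocks_crossI[of "Upper a" B "Upper c" ?B' "Lower c" "Lower a" n]
        blocks_crossI[of "Upper c" ?B' "Upper a" B "Lower a" "Lower c" n]
      unfolding BAC by fastforce
    then show False using pl B B' neq unfolding planar_def by auto
  qed
  then consider "A = {}" "C \<noteq> {}" | "A \<noteq> {}" "C = {}" | "A = C" "A \<noteq> {}"
    using ne BAC by blast
  then show thesis
  proof cases
    case 1
    then show thesis using that[of C] BAC B' range by auto
  next
    case 2
    then show thesis using that[of A] BAC B' range by auto
  next
    case 3
    then show thesis using that[of A] BAC range by auto
  qed
qed

text \<open>Both components are read off from the blocks: \<open>symmetric_planar_block\<close>
  ensures that no block is missed, and planarity yields the order conditions of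
  \<open>configs\<close>.\<close>

lemma symmetric_planar_eq_to_partition:
  assumes part: "partition_on (vertices n) \<alpha>" and pl: "planar n \<alpha>" and sym: "\<alpha> = pstar \<alpha>"
  obtains X k where "X \<in> configs n k" "\<alpha> = to_partition X"
proof -
  define N where "N = {A. Upper ` A \<in> \<alpha> \<and> Lower ` A \<in> \<alpha>}"
  define M where "M = {A. Upper ` A \<union> Lower ` A \<in> \<alpha>}"
  have meet: "B = C" if "B \<in> \<alpha>" "C \<in> \<alpha>" "v \<in> B" "v \<in> C" for B C v
    using part that unfolding partition_on_def disjoint_def by blast
  have ne: "{} \<notin> \<alpha>" and cover: "\<Union>\<alpha> = vertices n" using part by (auto simp: partition_on_def)
  have neNM: "A \<noteq> {}" if "A \<in> N \<union> M" for A
    using that ne unfolding N_def M_def by auto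
  have range: "A \<subseteq> {1..n}" if "A \<in> N \<union> M" for A
  proof -
    have "Upper ` A \<subseteq> \<Union>\<alpha>" using that unfolding N_def M_def by blast
    then show ?thesis unfolding cover vertices_eq by auto
  qed
  then have idx: "a \<in> {1..n}" if "A \<in> N \<union> M" "a \<in> A" for A a using that by blast
  have nocross: "\<not> blocks_cross n B C" if "B \<in> \<alpha>" "C \<in> \<alpha>" "B \<noteq> C" for B C
    using pl that unfolding planar_def by blast
  \<comment> \<open>Both sets come from the block containing \<open>Upper i\<close>, whose upper
    part determines them.\<close>
  have NM: "A = C" if A: "A \<in> N \<union> M" "i \<in> A" and C: "C \<in> N \<union> M" "i \<in> C" for A C i
  proof -
    obtain B where B: "B \<in> \<alpha>" "B = Upper ` A \<or> B = Upper ` A \<union> Lower ` A"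
      using A(1) unfolding N_def M_def by blast
    obtain D where D: "D \<in> \<alpha>" "D = Upper ` C \<or> D = Upper ` C \<union> Lower ` C"
      using C(1) unfolding N_def M_def by blast
    have "B = D" using meet[OF B(1) D(1), of "Upper i"] B(2) D(2) A(2) C(2) by auto
    moreover have "{i. Upper i \<in> B} = A" "{i. Upper i \<in> D} = C" using B(2) D(2) by auto
    ultimately show ?thesis by simp
  qed
  have disj: "N \<inter> M = {}"
  proof -
    have False if A: "A \<in> N" "A \<in> M" for A
    proof -
      obtain a where "a \<in> A" using neNM A by blast
      then have "Upper ` A = Upper ` A \<union> Lower ` A"
        using A meet[of "Upper ` A" "Upper ` A \<union> Lower ` A" "Upper a"]
        unfolding N_def M_def by blast
      then show False using \<open>a \<in> A\<close> by (auto simp: set_eq_iff)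
    qed
    then show ?thesis by blast
  qed
  have block: "\<exists>A. A \<in> N \<and> (B = Upper ` A \<or> B = Lower ` A) \<or> A \<in> M \<and> B = Upper ` A \<union> Lower ` A"
    if "B \<in> \<alpha>" for B
    using symmetric_planar_block[OF part pl sym that] that unfolding N_def M_def by (smt (verit) mem_Collect_eq)
  have "finite {1..n}" by simp
  then have "finite M" using range by (meson Pow_iff UnCI finite_Pow_iff finite_subset subsetI)
  have sepM: "right_of A C \<or> right_of C A" if "A \<in> M" "C \<in> M" "A \<noteq> C" for A C
  proof (rule ccontr)
    assume "\<not> (right_of A C \<or> right_of C A)"
    then obtain a c a' c' where *: "a \<in> A" "c \<in> C" "a \<le> c" "a' \<in> A" "c' \<in> C" "c' \<le> a'"
      unfolding right_of_def by (meson not_less)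
    have neq: "x \<noteq> y" if "x \<in> A" "y \<in> C" for x y
      using NM[of A x C] that \<open>A \<noteq> C\<close> \<open>A \<in> M\<close> \<open>C \<in> M\<close> by blast
    let ?B = "Upper ` A \<union> Lower ` A" and ?D = "Upper ` C \<union> Lower ` C"
    have BD: "?B \<in> \<alpha>" "?D \<in> \<alpha>" "?B \<noteq> ?D" using that unfolding M_def by auto
    \<comment> \<open>For transversal blocks enclosure already means crossing, with
      \<open>Lower y\<close> as the fourth vertex.\<close>
    have 1: "\<not> (x < y \<and> y < z)" if "x \<in> A" "y \<in> C" "z \<in> A" for x y z
      using blocks_crossI[of "Upper x" ?B "Upper y" ?D "Upper z" "Lower y" n] nocross[OF BD] that
        idx[of A z] \<open>A \<in> M\<close> idx[of C y] \<open>C \<in> M\<close> by auto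
    have 2: "\<not> (x < y \<and> y < z)" if "x \<in> C" "y \<in> A" "z \<in> C" for x y z
      using blocks_crossI[of "Upper x" ?D "Upper y" ?B "Upper z" "Lower y" n] nocross[OF BD(2,1)] BD(3) that
        idx[of C z] \<open>A \<in> M\<close> idx[of A y] \<open>C \<in> M\<close> by auto
    \<comment> \<open>Here \<open>a < c\<close> and \<open>c' < a'\<close>. If
      \<open>c < a'\<close>, then \<open>c\<close> lies between \<open>a\<close> and
      \<open>a'\<close>; if \<open>a' < c\<close>, then \<open>a'\<close> lies between
      \<open>c'\<close> and \<open>c\<close>.\<close>
    show False
      using 1[of a c a'] 1[of a c' a'] 2[of c' a c] 2[of c' a' c] * neq by (metis le_neq_implies_less linorder_neqE_nat)
  qed
  obtain Ms where Ms: "set Ms = M" "sorted_wrt right_of Ms"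
    using exists_sorted_right_of[OF \<open>finite M\<close> _ sepM] neNM by blast
  have "\<alpha> = to_partition (N, Ms)"
  proof (intro equalityI subsetI)
    fix B assume "B \<in> \<alpha>"
    then show "B \<in> to_partition (N, Ms)"
      using block[of B] unfolding to_partition_def Ms(1)[symmetric] by auto
  next
    fix B assume "B \<in> to_partition (N, Ms)"
    then show "B \<in> \<alpha>"
      unfolding to_partition_def fst_conv snd_conv Ms(1) N_def M_def by blast
  qed
  moreover have "(N, Ms) \<in> configs n (length Ms)"
  proof -
    have "partition_on {1..n} (N \<union> M)"
    proof (rule partition_onI)
      show "\<Union>(N \<union> M) = {1..n}"
      proof (intro equalityI subsetI)
        fix i assume "i \<in> {1..n}"
        then have "Upper i \<in> \<Union>\<alpha>" unfolding cover vertices_eq by simp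
        then obtain B where "B \<in> \<alpha>" "Upper i \<in> B" by blast
        then show "i \<in> \<Union>(N \<union> M)" using block[of B] by auto
      qed (use range in blast)
      show "{} \<notin> N \<union> M" using neNM by blast
      show "disjnt A C" if "A \<in> N \<union> M" "C \<in> N \<union> M" "A \<noteq> C" for A C
        using NM[of A _ C] that unfolding disjnt_def by blast
    qed
    moreover have "\<not> crosses A C" if "A \<in> N" "C \<in> N" "A \<noteq> C" for A C
    proof
      assume "crosses A C"
      then have "blocks_cross n (Upper ` A) (Upper ` C)"
        unfolding crosses_def blocks_cross_def by fastforce
      then show False using nocross[of "Upper ` A" "Upper ` C"] that unfolding N_def by auto
    qed
    moreover have "\<not> covers A C" if A: "A \<in> N" and C: "C \<in> M" for A C
    proof
      assume "covers A C"
      then obtain a b c where "a \<in> A" "b \<in> C" "c \<in> A" "a < b" "b < c"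
        unfolding covers_def by blast
      moreover have "b \<in> {1..n}" "c \<in> {1..n}" using idx calculation A C by blast+
      ultimately have "blocks_cross n (Upper ` A) (Upper ` C \<union> Lower ` C)"
        by (intro blocks_crossI[of "Upper a" _ "Upper b" _ "Upper c" "Lower b"]) auto
      moreover have "Upper ` A \<noteq> Upper ` C \<union> Lower ` C"
        using \<open>b \<in> C\<close> by (auto simp: set_eq_iff)
      ultimately show False using nocross A C unfolding N_def M_def by blast
    qed
    ultimately show ?thesis
      using disj Ms unfolding configs_def by auto
  qed
  ultimately show thesis using that by blast
qed

section \<open>Counting the projections of rank at most 2\<close>

lemma Q_PP_eq: "Q_PP n = to_partition ` (\<Union>k\<le>2. configs n k)"
proof (intro equalityI subsetI)
  fix \<alpha> assume \<alpha>: "\<alpha> \<in> Q_PP n"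
  then have "partition_on (vertices n) \<alpha>" "planar n \<alpha>" "\<alpha> = pstar \<alpha>"
    by (auto simp: Q_PP_def projections_def planar_partition_monoid_def partition_monoid_def)
  then obtain X k where X: "X \<in> configs n k" "\<alpha> = to_partition X"
    by (rule symmetric_planar_eq_to_partition)
  then have "k \<le> 2"
    using \<alpha> prank_to_partition by (cases X) (auto simp: Q_PP_def)
  then show "\<alpha> \<in> to_partition ` (\<Union>k\<le>2. configs n k)" using X by blast
next
  fix \<alpha> assume "\<alpha> \<in> to_partition ` (\<Union>k\<le>2. configs n k)"
  then obtain N Ms k where k: "k \<le> 2" and X: "(N, Ms) \<in> configs n k" "\<alpha> = to_partition (N, Ms)"
    by auto
  have "partition_on {1..n} (N \<union> set Ms)" "N \<inter> set Ms = {}"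
    using X(1) by (auto simp: configs_def)
  then show "\<alpha> \<in> Q_PP n"
    using k X planar_to_partition prank_to_partition partition_on_to_partition pmult_to_partition
      pstar_to_partition
    by (auto simp: Q_PP_def projections_def planar_partition_monoid_def partition_monoid_def)
qed

theorem proposition7p6:
  fixes n :: nat
  shows "real (card (Q_PP n)) = catalan (n + 2) - 2 * catalan (n + 1) + catalan n"
proof -
  have "card (Q_PP n) = card (\<Union>k\<le>2. configs n k)"
    unfolding Q_PP_eq by (intro card_image inj_on_subset[OF inj_on_to_partition]) auto
  also have "\<dots> = (\<Sum>k\<le>2. card (configs n k))"
    \<comment> \<open>Configurations for different \<open>k\<close> are distinct because
      \<open>k\<close> is the length of their stack.\<close>
    by (intro card_UN_disjoint) (auto simp: finite_configs, auto simp: configs_def)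
  finally show ?thesis using card_configs_le_2 by simp
qed

end
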